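(* Let $L_1,L_2>0$, $M>L_2$, $0\le\rho<1$, $\kappa>0$ and $\Delta\ge 0$. There exists a constant $C>0$, depending only on $L_1,L_2,M,\rho,\kappa,\Delta$, with the following property. Let $f:\mathbb{R}^d\to\mathbb{R}$ satisfy Assumption A with Lipschitz constants $L_1,L_2$ and the local error bound condition with constants $\kappa$ and some $r>0$, let $x_0\in\mathbb{R}^d$ with $f(x_0)-f^\star=\Delta$, and let $\{x_k\}_{k\ge0}$ be any sequence generated by the algorithm CRm with parameters $M,\rho$ started at $x_0$. Then $\{x_k\}_{k\ge 0}$ converges quadratically to a point $x^\star\in\mathcal{X}$, where $\mathcal{X}$ is the set of second-order stationary points of $f$; that is, $x_k\to x^\star$ and there exists an integer $k_1$ such that for all $k\ge k_1$, $$\|x_{k+1}-x^\star\|\le C\,\|x_k-x^\star\|^2 .$$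
   Context: Assumption A on $f:\mathbb{R}^d\to\mathbb{R}$ (with constants $L_1,L_2$): (1) $f$ is twice continuously differentiable and bounded below, $f^\star:=\inf_{x\in\mathbb{R}^d} f(x)>-\infty$; (2) for every $\alpha\in\mathbb{R}$ the sublevel set $\{x: f(x)\le\alpha\}$ is bounded; (3) $\nabla f$ is $L_1$-Lipschitz and $\nabla^2 f$ is $L_2$-Lipschitz (Euclidean norm on vectors, operator norm on matrices). The function $f$ is possibly nonconvex. $\mathcal{X}$ denotes the set of second-order stationary points of $f$, i.e. points $x$ with $\nabla f(x)=0$ and $\nabla^2 f(x)\succcurlyeq 0$. Local error bound condition: there exist $\kappa,r>0$ such that for all $x$ with $\mathrm{dist}(x,\mathcal{X})\le r$ one has $\mathrm{dist}(x,\mathcal{X})\le\kappa\|\nabla f(x)\|$, where $\mathrm{dist}(x,\mathcal{X})$ is the Euclidean point-to-set distance. Algorithm CRm (parameters $M,\rho$; initialization $x_0=y_0\in\mathbb{R}^d$). For $k=0,1,2,\dots$: (Cubic step) $s_{k+1}\in\operatorname{argmin}_{s\in\mathbb{R}^d}\ \nabla f(x_k)^\top s+\frac12 s^\top\nabla^2 f(x_k)s+\frac{M}{6}\|s\|^3$ (a global minimizer), and $y_{k+1}=x_k+s_{k+1}$. (Momentum step) $\beta_{k+1}=\min\{\rho,\ \|\nabla f(y_{k+1})\|,\ \|y_{k+1}-x_k\|\}$ and $v_{k+1}=y_{k+1}+\beta_{k+1}(y_{k+1}-y_k)$. (Monotone step) $x_{k+1}\in\operatorname{argmin}_{x\in\{y_{k+1},v_{k+1}\}}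 f(x)$. *)

theory Defs
  imports "HOL-Analysis.Analysis" "HOL-Library.Poly_Mapping"
begin

text \<open>
  The constant in the theorem must not depend on the dimension, so the dimension is quantified inside
  the statement and cannot be a type parameter. The spaces R^d are therefore
  realised, for all d at once, as subsets of one inner product space: the finitely supported real
  sequences \<open>nat \<Rightarrow>\<^sub>0 real\<close> with the Euclidean inner product.
\<close>

subsection \<open>Finitely supported families as an inner product space\<close>

instantiation poly_mapping :: (type, real_vector) real_vector
begin

lift_definition scaleR_poly_mapping :: "real \<Rightarrow> ('a \<Rightarrow>\<^sub>0 'b) \<Rightarrow> ('a \<Rightarrow>\<^sub>0 'b)"
  is "\<lambda>r f i. scaleR r (f i)"
  by (rule finite_subset) auto

instance
  by standard (transfer; simp add: fun_eq_iff scaleR_add_right scaleR_add_left)+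

end

instantiation poly_mapping :: (type, real_inner) real_inner
begin

definition inner_poly_mapping :: "('a \<Rightarrow>\<^sub>0 'b) \<Rightarrow> ('a \<Rightarrow>\<^sub>0 'b) \<Rightarrow> real"
  where "inner_poly_mapping x y = (\<Sum>i\<in>Poly_Mapping.keys x.
    Poly_Mapping.lookup x i \<bullet> Poly_Mapping.lookup y i)"

definition norm_poly_mapping :: "('a \<Rightarrow>\<^sub>0 'b) \<Rightarrow> real"
  where "norm_poly_mapping x = sqrt (x \<bullet> x)"

definition dist_poly_mapping :: "('a \<Rightarrow>\<^sub>0 'b) \<Rightarrow> ('a \<Rightarrow>\<^sub>0 'b) \<Rightarrow> real"
  where "dist_poly_mapping x y = norm (x - y)"

definition sgn_poly_mapping :: "('a \<Rightarrow>\<^sub>0 'b) \<Rightarrow> ('a \<Rightarrow>\<^sub>0 'b)"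
  where "sgn_poly_mapping x = x /\<^sub>R norm x"

definition uniformity_poly_mapping :: "(('a \<Rightarrow>\<^sub>0 'b) \<times> ('a \<Rightarrow>\<^sub>0 'b)) filter"
  where "uniformity_poly_mapping = (INF e\<in>{0<..}. principal {(x, y). dist x y < e})"

definition open_poly_mapping :: "('a \<Rightarrow>\<^sub>0 'b) set \<Rightarrow> bool"
  where "open_poly_mapping U \<longleftrightarrow> (\<forall>x\<in>U. \<forall>\<^sub>F (x', y) in uniformity. x' = x \<longrightarrow> y \<in> U)"

lemma inner_poly_mapping_superset:
  fixes x y :: "'a \<Rightarrow>\<^sub>0 'b"
  assumes "finite S" "Poly_Mapping.keys x \<subseteq> S"
  shows "x \<bullet> y = (\<Sum>i\<in>S. Poly_Mapping.lookup x i \<bullet> Poly_Mapping.lookup y i)"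
  unfolding inner_poly_mapping_def
  by (rule sum.mono_neutral_left) (use assms in \<open>auto simp: in_keys_iff\<close>)

instance
proof
  fix x y z :: "'a \<Rightarrow>\<^sub>0 'b" and r :: real
  let ?S = "Poly_Mapping.keys x \<union> Poly_Mapping.keys y"
  show "x \<bullet> y = y \<bullet> x"
    by (simp add: inner_poly_mapping_superset[of ?S] inner_commute)
  have "Poly_Mapping.keys (x + y) \<subseteq> ?S" by (rule Poly_Mapping.keys_add)
  then show "(x + y) \<bullet> z = x \<bullet> z + y \<bullet> z"
    by (simp add: inner_poly_mapping_superset[of ?S] lookup_add inner_add_left sum.distrib)
  have "Poly_Mapping.keys (r *\<^sub>R x) \<subseteq> Poly_Mapping.keys x"
    by (auto simp: in_keys_iff scaleR_poly_mapping.rep_eq)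
  then show "(r *\<^sub>R x) \<bullet> y = r * (x \<bullet> y)"
    by (simp add: inner_poly_mapping_superset[of "Poly_Mapping.keys x"] scaleR_poly_mapping.rep_eq
        sum_distrib_left)
  show "0 \<le> x \<bullet> x"
    by (simp add: inner_poly_mapping_def sum_nonneg)
  show "x \<bullet> x = 0 \<longleftrightarrow> x = 0"
    by (auto simp: inner_poly_mapping_def sum_nonneg_eq_0_iff in_keys_iff
        intro!: poly_mapping_eqI)
qed (simp_all add: norm_poly_mapping_def dist_poly_mapping_def sgn_poly_mapping_def
      uniformity_poly_mapping_def open_poly_mapping_def)

end

definition euclid :: "nat \<Rightarrow> (nat \<Rightarrow>\<^sub>0 real) set"
  where "euclid d = {x. \<forall>i\<ge>d. Poly_Mapping.lookup x i = 0}"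

subsection \<open>Gradient and Hessian on R^d\<close>

text \<open>
  A function on R^d is a function on \<open>nat \<Rightarrow>\<^sub>0 real\<close> of which only the values on
  \<open>euclid d\<close> matter; accordingly derivatives are taken within \<open>euclid d\<close>, and a derivative is
  determined on (and only used on) directions in \<open>euclid d\<close>. The lemmas \<open>grad_eqI\<close>,
  \<open>grad_works\<close> and \<open>hess_eq\<close> below show that no arbitrary choice is involved there.
\<close>

definition grad :: "nat \<Rightarrow> ((nat \<Rightarrow>\<^sub>0 real) \<Rightarrow> real) \<Rightarrow> (nat \<Rightarrow>\<^sub>0 real) \<Rightarrow> (nat \<Rightarrow>\<^sub>0 real)"
  where "grad d f x =
    (THE g. g \<in> euclid d \<and> (f has_derivative (\<lambda>h. g \<bullet> h)) (at x within euclid d))"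

definition hess ::
    "nat \<Rightarrow> ((nat \<Rightarrow>\<^sub>0 real) \<Rightarrow> real) \<Rightarrow> (nat \<Rightarrow>\<^sub>0 real) \<Rightarrow> (nat \<Rightarrow>\<^sub>0 real) \<Rightarrow> (nat \<Rightarrow>\<^sub>0 real)"
  where "hess d f x = frechet_derivative (grad d f) (at x within euclid d)"

text \<open>The library's \<^const>\<open>onorm\<close>, with the supremum restricted to R^d.\<close>

definition opnorm :: "nat \<Rightarrow> ((nat \<Rightarrow>\<^sub>0 real) \<Rightarrow> (nat \<Rightarrow>\<^sub>0 real)) \<Rightarrow> real"
  where "opnorm d A = (SUP h\<in>euclid d. norm (A h) / norm h)"

definition C2_on_euclid :: "nat \<Rightarrow> ((nat \<Rightarrow>\<^sub>0 real) \<Rightarrow> real) \<Rightarrow> bool"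
  where "C2_on_euclid d f \<longleftrightarrow>
    f differentiable_on euclid d \<and>
    grad d f differentiable_on euclid d \<and>
    (\<forall>x\<in>euclid d.
      ((\<lambda>y. opnorm d (\<lambda>h. hess d f y h - hess d f x h)) \<longlongrightarrow> 0) (at x within euclid d))"

lemma subspace_euclid: "subspace (euclid d)"
  by (auto simp: subspace_def euclid_def lookup_add scaleR_poly_mapping.rep_eq)

lemma has_derivative_within_euclid_unique:
  fixes f :: "(nat \<Rightarrow>\<^sub>0 real) \<Rightarrow> 'b::real_normed_vector"
  assumes A: "(f has_derivative A) (at x within euclid d)"
    and B: "(f has_derivative B) (at x within euclid d)"
    and x: "x \<in> euclid d" and h: "h \<in> euclid d"
  shows "A h = B h"
proof -
  let ?l = "\<lambda>t::real. x + t *\<^sub>R h"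
  have l: "(?l has_derivative (\<lambda>t. t *\<^sub>R h)) (at 0)"
    by (auto intro!: derivative_eq_intros)
  have sub: "range ?l \<subseteq> euclid d"
    using x h subspace_euclid[of d] by (auto intro: subspace_add subspace_scale)
  have "(f \<circ> ?l has_derivative D \<circ> (\<lambda>t. t *\<^sub>R h)) (at 0)"
    if "(f has_derivative D) (at x within euclid d)" for D
    using diff_chain_within[OF l, of f D] has_derivative_subset[OF that sub] by simp
  from has_derivative_unique[OF this[OF A] this[OF B]] show ?thesis
    by (metis comp_apply scaleR_one)
qed

lemma grad_eqI:
  assumes x: "x \<in> euclid d" and g: "g \<in> euclid d"
    and D: "(f has_derivative (\<lambda>h. g \<bullet> h)) (at x within euclid d)"
  shows "grad d f x = g"
  unfolding grad_def
proof (rule the_equality)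
  show "g \<in> euclid d \<and> (f has_derivative (\<lambda>h. g \<bullet> h)) (at x within euclid d)"
    using g D by simp
next
  fix g' assume g': "g' \<in> euclid d \<and> (f has_derivative (\<lambda>h. g' \<bullet> h)) (at x within euclid d)"
  then have "g' - g \<in> euclid d"
    using g subspace_euclid[of d] by (auto intro: subspace_diff)
  then have "g' \<bullet> (g' - g) = g \<bullet> (g' - g)"
    using has_derivative_within_euclid_unique[of f "\<lambda>h. g' \<bullet> h" x d "\<lambda>h. g \<bullet> h"] g' D x by simp
  then have "(g' - g) \<bullet> (g' - g) = 0"
    by (simp only: inner_diff_left)
  then show "g' = g" by simp
qed

lemma grad_works:
  assumes x: "x \<in> euclid d" and f: "f differentiable (at x within euclid d)"
  shows "grad d f x \<in> euclid d"
    and "(f has_derivative (\<lambda>h. grad d f x \<bullet> h)) (at x within euclid d)"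
proof -
  from f obtain D where D: "(f has_derivative D) (at x within euclid d)"
    by (auto simp: differentiable_def)
  interpret D: bounded_linear D using D by (rule has_derivative_bounded_linear)
  let ?e = "\<lambda>i. Poly_Mapping.single i (1::real)"
  have inner_e: "?e i \<bullet> h = Poly_Mapping.lookup h i" for i h
    by (simp add: inner_poly_mapping_def lookup_single)
  define g where "g = (\<Sum>i<d. D (?e i) *\<^sub>R ?e i)"
  have g: "g \<in> euclid d"
    unfolding g_def using subspace_euclid[of d]
    by (intro subspace_sum subspace_scale) (auto simp: euclid_def lookup_single)
  have "D h = g \<bullet> h" if h: "h \<in> euclid d" for h
  proof -
    have "h = (\<Sum>i<d. Poly_Mapping.lookup h i *\<^sub>R ?e i)"
      using h by (intro poly_mapping_eqI)
        (auto simp: euclid_def lookup_sum scaleR_poly_mapping.rep_eq lookup_single when_def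
          if_distrib[of "(*) _"] cong: if_cong)
    then have "D h = D (\<Sum>i<d. Poly_Mapping.lookup h i *\<^sub>R ?e i)" by simp
    also have "\<dots> = (\<Sum>i<d. Poly_Mapping.lookup h i * D (?e i))"
      by (simp add: D.sum D.scaleR)
    also have "\<dots> = g \<bullet> h"
      by (simp add: g_def inner_sum_left inner_e mult.commute)
    finally show ?thesis .
  qed
  moreover have "y - x \<in> euclid d" if "y \<in> euclid d" for y
    using that x subspace_euclid[of d] by (auto intro: subspace_diff)
  ultimately have "(f has_derivative (\<lambda>h. g \<bullet> h)) (at x within euclid d)"
    using D unfolding has_derivative_within
    by (auto simp: bounded_linear_inner_right elim!: Lim_transform_eventually
        intro!: eventually_at_filter[THEN iffD2])
  with grad_eqI[OF x g] g show "grad d f x \<in> euclid d"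
    and "(f has_derivative (\<lambda>h. grad d f x \<bullet> h)) (at x within euclid d)" by auto
qed

lemma hess_eq:
  assumes "x \<in> euclid d" "h \<in> euclid d" "(grad d f has_derivative A) (at x within euclid d)"
  shows "hess d f x h = A h"
  unfolding hess_def
  using assms has_derivative_within_euclid_unique frechet_derivative_works differentiableI
  by blast

subsection \<open>Standing assumptions\<close>

definition fstar :: "nat \<Rightarrow> ((nat \<Rightarrow>\<^sub>0 real) \<Rightarrow> real) \<Rightarrow> real"
  where "fstar d f = (INF x\<in>euclid d. f x)"

definition assumption_A :: "nat \<Rightarrow> real \<Rightarrow> real \<Rightarrow> ((nat \<Rightarrow>\<^sub>0 real) \<Rightarrow> real) \<Rightarrow> bool"
  where "assumption_A d L1 L2 f \<longleftrightarrow>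
    C2_on_euclid d f \<and> bdd_below (f ` euclid d) \<and>
    (\<forall>\<alpha>. bounded {x \<in> euclid d. f x \<le> \<alpha>}) \<and>
    L1-lipschitz_on (euclid d) (grad d f) \<and>
    (\<forall>x\<in>euclid d. \<forall>y\<in>euclid d.
      opnorm d (\<lambda>h. hess d f x h - hess d f y h) \<le> L2 * dist x y)"

definition second_order_stationary ::
    "nat \<Rightarrow> ((nat \<Rightarrow>\<^sub>0 real) \<Rightarrow> real) \<Rightarrow> (nat \<Rightarrow>\<^sub>0 real) set"
  where "second_order_stationary d f =
    {x \<in> euclid d. grad d f x = 0 \<and> (\<forall>h\<in>euclid d. 0 \<le> h \<bullet> hess d f x h)}"

text \<open>
  By convention \<^const>\<open>infdist\<close> to the empty set is 0. Under \<open>assumption_A\<close> a global minimiser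
  exists, so the set of second-order stationary points is never empty below.
\<close>

definition local_error_bound ::
    "nat \<Rightarrow> ((nat \<Rightarrow>\<^sub>0 real) \<Rightarrow> real) \<Rightarrow> real \<Rightarrow> real \<Rightarrow> bool"
  where "local_error_bound d f \<kappa> r \<longleftrightarrow>
    (\<forall>x\<in>euclid d. infdist x (second_order_stationary d f) \<le> r \<longrightarrow>
      infdist x (second_order_stationary d f) \<le> \<kappa> * norm (grad d f x))"

subsection \<open>Cubic regularised Newton method with momentum\<close>

definition cubic_model ::
    "nat \<Rightarrow> ((nat \<Rightarrow>\<^sub>0 real) \<Rightarrow> real) \<Rightarrow> real \<Rightarrow> (nat \<Rightarrow>\<^sub>0 real) \<Rightarrow> (nat \<Rightarrow>\<^sub>0 real) \<Rightarrow> real"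
  where "cubic_model d f M x s =
    grad d f x \<bullet> s + 1 / 2 * (s \<bullet> hess d f x s) + M / 6 * norm s ^ 3"

text \<open>
  The argmin sets need not be singletons: \<open>x\<close> is generated by the algorithm if it arises from some
  choice of minimisers in every cubic step and every monotone step.
\<close>

definition CRm_sequence ::
    "nat \<Rightarrow> ((nat \<Rightarrow>\<^sub>0 real) \<Rightarrow> real) \<Rightarrow> real \<Rightarrow> real \<Rightarrow> (nat \<Rightarrow>\<^sub>0 real) \<Rightarrow>
      (nat \<Rightarrow> (nat \<Rightarrow>\<^sub>0 real)) \<Rightarrow> bool"
  where "CRm_sequence d f M \<rho> x0 x \<longleftrightarrow>
    x0 \<in> euclid d \<and>
    (\<exists>y s v \<beta>. x 0 = x0 \<and> y 0 = x0 \<and>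
      (\<forall>k.
        is_arg_min (cubic_model d f M (x k)) (\<lambda>z. z \<in> euclid d) (s (Suc k)) \<and>
        y (Suc k) = x k + s (Suc k) \<and>
        \<beta> (Suc k) = Min {\<rho>, norm (grad d f (y (Suc k))), norm (y (Suc k) - x k)} \<and>
        v (Suc k) = y (Suc k) + \<beta> (Suc k) *\<^sub>R (y (Suc k) - y k) \<and>
        is_arg_min f (\<lambda>z. z \<in> {y (Suc k), v (Suc k)}) (x (Suc k))))"

end

theory Submission
  imports Defs
begin

text \<open>
  Write \<open>D k\<close> for the distance from \<open>x k\<close> to the set of second-order stationary points and \<open>s\<close> for
  the step taken from \<open>x k\<close>. The proof compares everything with \<open>norm s\<close>, and \<open>norm s\<close> with \<open>D k\<close>.

  Global minimality of the step in the cubic model has three consequences, the first two through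
  Taylor expansion with a Lipschitz Hessian: \<open>f\<close> drops by a multiple of \<open>norm s ^ 3\<close> (\<open>cubic_step_descent\<close>), the new
  gradient is \<open>O(norm s ^ 2)\<close> (\<open>cubic_step_gradient\<close>), and the Hessian at the old point is bounded
  below by \<open>- O(norm s)\<close> (\<open>cubic_step_curvature\<close>). Since \<open>f\<close> is bounded below, the steps tend to 0.
  The momentum displacement is at most a gradient norm times a bounded quantity, so it tends to 0 as
  well; hence every limit point of the iterates has zero gradient and positive semidefinite Hessian,
  and by compactness of the sublevel sets \<open>D k\<close> tends to 0 (\<open>distances_vanish\<close>).

  The rate rests on \<open>norm s \<le> 5 * D k\<close> (\<open>cubic_step_length\<close>). It yields that the gradient at \<open>y (Suc k)\<close>
  is \<open>O((D k)\<^sup>2)\<close>, so the error bound puts \<open>y (Suc k)\<close> within \<open>O((D k)\<^sup>2)\<close> of the stationary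
  set; the extra displacement by momentum is of the same order, because the momentum parameter is at
  most that gradient norm. Thus \<open>D (Suc k) = O((D k)\<^sup>2)\<close> (\<open>eventually_distance_quadratic\<close>), while
  consecutive iterates are at most \<open>10 * D k\<close> apart. The iterates therefore form a Cauchy sequence
  whose distance to its limit is at most \<open>20 * D k\<close> (\<open>tail_within_twice_residual\<close>), and \<open>D k\<close> is
  in turn at most that distance: the quadratic decay of \<open>D\<close> becomes quadratic convergence, with
  constant \<open>250 * (\<kappa> + 1) * (L2 + M)\<close>.

  The dimension enters this argument through the compactness of closed balls alone. It is therefore
  carried out on a subspace of a real inner product space whose closed balls are compact, and
  \<open>euclid d\<close> is such a subspace (\<open>compact_euclid_cball\<close>).
\<close>

section \<open>Elementary estimates\<close>

text \<open>
  Integration of the bound on the derivative; both Taylor estimates below are instances, with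
  \<open>n = 1\<close> for the gradient and \<open>n = 2\<close> for the function.
\<close>
lemma abs_increment_le_of_deriv_power:
  fixes p p' :: "real \<Rightarrow> real"
  assumes D: "\<And>t. (p has_real_derivative p' t) (at t)"
    and b: "\<And>t. 0 \<le> t \<Longrightarrow> \<bar>p' t\<bar> \<le> K * t ^ n"
  shows "\<bar>p 1 - p 0\<bar> \<le> K / (1 + real n)"
proof -
  have pw: "((\<lambda>t. K * t ^ Suc n / (1 + real n)) has_real_derivative K * t ^ n) (at t)" for t
  proof -
    have "((\<lambda>t. K * t ^ Suc n / (1 + real n)) has_real_derivative
        K * ((1 + real n) * t ^ n) / (1 + real n)) (at t)"
      using DERIV_pow[of "Suc n" t] by (intro DERIV_cdivide DERIV_cmult) simp
    then show ?thesis by (simp add: add_nonneg_eq_0_iff)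
  qed
  have "(\<lambda>t. p t - K * t ^ Suc n / (1 + real n)) 1 \<le> (\<lambda>t. p t - K * t ^ Suc n / (1 + real n)) 0"
  proof (rule DERIV_nonpos_imp_nonincreasing[of 0 1 "\<lambda>t. p t - K * t ^ Suc n / (1 + real n)"])
    fix t :: real assume "0 \<le> t" "t \<le> 1"
    then have "p' t - K * t ^ n \<le> 0" using b[of t] by linarith
    with DERIV_diff[OF D[of t] pw[of t]]
    show "\<exists>y. ((\<lambda>t. p t - K * t ^ Suc n / (1 + real n)) has_real_derivative y) (at t) \<and> y \<le> 0"
      by blast
  qed simp
  moreover
  have "(\<lambda>t. p t + K * t ^ Suc n / (1 + real n)) 0 \<le> (\<lambda>t. p t + K * t ^ Suc n / (1 + real n)) 1"
  proof (rule DERIV_nonneg_imp_nondecreasing[of 0 1 "\<lambda>t. p t + K * t ^ Suc n / (1 + real n)"])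
    fix t :: real assume "0 \<le> t" "t \<le> 1"
    then have "p' t + K * t ^ n \<ge> 0" using b[of t] by linarith
    with DERIV_add[OF D[of t] pw[of t]]
    show "\<exists>y. ((\<lambda>t. p t + K * t ^ Suc n / (1 + real n)) has_real_derivative y) (at t) \<and> 0 \<le> y"
      by blast
  qed simp
  ultimately show ?thesis by auto
qed

lemma linear_coeff_zero_of_nonneg:
  fixes P K :: real
  assumes "\<And>t. \<bar>t\<bar> \<le> 1 \<Longrightarrow> 0 \<le> t * P + K * t\<^sup>2"
  shows "P = 0"
proof (rule ccontr)
  assume P: "P \<noteq> 0"
  define c where "c = \<bar>P\<bar> + \<bar>K\<bar> + 1"
  have c: "c > 0" "\<bar>P\<bar> \<le> c" "K < c" unfolding c_def by linarith+
  have "\<bar>- (P / c)\<bar> \<le> 1" using c by (simp add: abs_divide)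
  moreover have "- (P / c) * P + K * (- (P / c))\<^sup>2 = P\<^sup>2 / c * (K / c - 1)"
    using c by (simp add: power2_eq_square field_simps)
  ultimately have "0 \<le> P\<^sup>2 / c * (K / c - 1)"
    using assms[of "- (P / c)"] by simp
  moreover have "P\<^sup>2 / c * (K / c - 1) < 0"
    using P c by (intro mult_pos_neg) (auto simp: field_simps)
  ultimately show False by linarith
qed

text \<open>
  The cubed norm expanded to second order, without differentiating the norm at 0. With
  \<open>a = norm (s + w)\<close> and \<open>b = norm s\<close> it comes from factoring
  \<open>a ^ 3 - b ^ 3 - 3 / 2 * b * (a\<^sup>2 - b\<^sup>2) = (a - b)\<^sup>2 * (a + b / 2)\<close>.
\<close>
lemma norm_cube_add_le:
  fixes s w :: "'a::real_inner"
  shows "norm (s + w) ^ 3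
    \<le> norm s ^ 3 + 3 * norm s * (s \<bullet> w) + (3 * norm s + norm w) * (norm w)\<^sup>2"
proof -
  define a b c where "a = norm (s + w)" and "b = norm s" and "c = norm w"
  have sq: "a\<^sup>2 = b\<^sup>2 + 2 * (s \<bullet> w) + c\<^sup>2"
    unfolding a_def b_def c_def
    by (simp add: power2_norm_eq_inner inner_add_left inner_add_right inner_commute)
  have "a \<le> b + c" "b \<le> a + c"
    unfolding a_def b_def c_def using norm_triangle_ineq[of s w] norm_triangle_ineq4[of "s+w" w] by auto
  then have d: "\<bar>a - b\<bar> \<le> c" by linarith
  have pos: "0 \<le> a" "0 \<le> b" "0 \<le> c" by (simp_all add: a_def b_def c_def)
  have "a ^ 3 = b ^ 3 + 3 / 2 * b * (a\<^sup>2 - b\<^sup>2) + (a - b)\<^sup>2 * (a + b / 2)"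
    by (simp add: field_simps power2_eq_square power3_eq_cube)
  also have "(a - b)\<^sup>2 * (a + b / 2) \<le> c\<^sup>2 * (3 / 2 * b + c)"
    using d pos \<open>a \<le> b + c\<close> by (intro mult_mono) (auto simp: abs_le_square_iff[symmetric])
  finally show ?thesis
    unfolding sq a_def[symmetric] b_def[symmetric] c_def[symmetric] by (simp add: field_simps)
qed

text \<open>
  The inequality is homogeneous of degree 3. If \<open>a\<close> exceeded \<open>5 * b\<close>, the left side would be at
  least \<open>L / 2 * 4 / 5 * a ^ 3\<close> and the right side at most \<open>L / 2 * 78 / 125 * a ^ 3\<close>; the factor 4
  in place of 5 would be too small for this comparison.
\<close>
lemma bounded_by_multiple_of_cubic_ineq:
  fixes a b L M :: real
  assumes "0 \<le> a" "0 \<le> b" "0 < L" "L \<le> M"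
    and le: "M / 2 * (a\<^sup>2 * (a - b)) \<le> L / 2 * b\<^sup>2 * (a + b) + L * b * (a + b)\<^sup>2"
  shows "a \<le> 5 * b"
proof (rule ccontr)
  assume "\<not> a \<le> 5 * b"
  then have lt: "5 * b < a" by simp
  with assms have a: "0 < a" by linarith
  have "L / 2 * (a\<^sup>2 * (a - b)) \<le> M / 2 * (a\<^sup>2 * (a - b))"
    using assms lt by (intro mult_right_mono mult_nonneg_nonneg) auto
  also note le
  finally have "L * (a\<^sup>2 * (a - b)) \<le> L * (b\<^sup>2 * (a + b) + 2 * b * (a + b)\<^sup>2)"
    by (simp add: field_simps)
  then have "a\<^sup>2 * (a - b) \<le> b\<^sup>2 * (a + b) + 2 * b * (a + b)\<^sup>2"
    using \<open>0 < L\<close> by simp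
  also have "\<dots> \<le> (a / 5)\<^sup>2 * (a + a / 5) + 2 * (a / 5) * (a + a / 5)\<^sup>2"
    using assms lt a by (intro add_mono mult_mono power_mono) auto
  also have "\<dots> = 78 / 125 * a ^ 3"
    by (simp add: power2_eq_square power3_eq_cube field_simps)
  finally have "a\<^sup>2 * (a - b) \<le> 78 / 125 * a ^ 3" .
  moreover have "a\<^sup>2 * (4 / 5 * a) \<le> a\<^sup>2 * (a - b)"
    using lt by (intro mult_left_mono) auto
  ultimately have "4 / 5 * a ^ 3 \<le> 78 / 125 * a ^ 3"
    by (simp add: power2_eq_square power3_eq_cube)
  moreover have "a ^ 3 > 0" using a by simp
  ultimately show False by linarith
qed

section \<open>Functions with Lipschitz Hessian on a subspace\<close>

text \<open>
  Derivatives are only required along lines of \<open>V\<close>, and all vector estimates below are tested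
  against directions in \<open>V\<close>, so that \<open>H x\<close> need not map \<open>V\<close> into itself.
\<close>
locale lipschitz_hessian =
  fixes V :: "'a::real_inner set" and f :: "'a \<Rightarrow> real" and g :: "'a \<Rightarrow> 'a"
    and H :: "'a \<Rightarrow> 'a \<Rightarrow> 'a" and L :: real
  assumes V: "subspace V"
    and g_in: "\<And>x. x \<in> V \<Longrightarrow> g x \<in> V"
    and f_deriv: "\<And>x u t. x \<in> V \<Longrightarrow> u \<in> V \<Longrightarrow>
      ((\<lambda>t. f (x + t *\<^sub>R u)) has_real_derivative g (x + t *\<^sub>R u) \<bullet> u) (at t)"
    and g_deriv: "\<And>x u w t. x \<in> V \<Longrightarrow> u \<in> V \<Longrightarrow>
      ((\<lambda>t. g (x + t *\<^sub>R u) \<bullet> w) has_real_derivative H (x + t *\<^sub>R u) u \<bullet> w) (at t)"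
    and H_linear: "\<And>x. x \<in> V \<Longrightarrow> linear (H x)"
    and H_lipschitz: "\<And>x y h. x \<in> V \<Longrightarrow> y \<in> V \<Longrightarrow> h \<in> V \<Longrightarrow>
      norm (H x h - H y h) \<le> L * norm (x - y) * norm h"
    and L_pos: "0 < L"
begin

lemma line_in: "x \<in> V \<Longrightarrow> u \<in> V \<Longrightarrow> x + t *\<^sub>R u \<in> V"
  using V by (auto intro: subspace_add subspace_scale)

lemma taylor_gradient:
  assumes "x \<in> V" "u \<in> V"
  shows "\<bar>(g (x + u) - g x - H x u) \<bullet> w\<bar> \<le> L / 2 * (norm u)\<^sup>2 * norm w"
proof -
  define p where "p t = g (x + t *\<^sub>R u) \<bullet> w - t * (H x u \<bullet> w)" for t
  have "\<bar>p 1 - p 0\<bar> \<le> L * (norm u)\<^sup>2 * norm w / (1 + real 1)"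
  proof (rule abs_increment_le_of_deriv_power)
    fix t :: real
    show "(p has_real_derivative H (x + t *\<^sub>R u) u \<bullet> w - H x u \<bullet> w) (at t)"
      unfolding p_def using g_deriv[OF assms, of w t]
      by (auto intro!: derivative_eq_intros)
    assume t: "0 \<le> t"
    have "\<bar>H (x + t *\<^sub>R u) u \<bullet> w - H x u \<bullet> w\<bar> \<le> norm (H (x + t *\<^sub>R u) u - H x u) * norm w"
      by (metis Cauchy_Schwarz_ineq2 inner_diff_left)
    also have "\<dots> \<le> (L * norm (x + t *\<^sub>R u - x) * norm u) * norm w"
      using assms by (intro mult_right_mono H_lipschitz line_in) auto
    also have "\<dots> = L * (norm u)\<^sup>2 * norm w * t ^ 1"
      using t by (simp add: power2_eq_square)
    finally show "\<bar>H (x + t *\<^sub>R u) u \<bullet> w - H x u \<bullet> w\<bar> \<le> L * (norm u)\<^sup>2 * norm w * t ^ 1" .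
  qed
  then show ?thesis by (simp add: p_def inner_diff_left algebra_simps)
qed

lemma taylor_function:
  assumes "x \<in> V" "u \<in> V"
  shows "\<bar>f (x + u) - f x - g x \<bullet> u - (u \<bullet> H x u) / 2\<bar> \<le> L / 6 * norm u ^ 3"
proof -
  define p where "p t = f (x + t *\<^sub>R u) - t * (g x \<bullet> u) - t\<^sup>2 / 2 * (H x u \<bullet> u)" for t
  have "\<bar>p 1 - p 0\<bar> \<le> L / 2 * norm u ^ 3 / (1 + real 2)"
  proof (rule abs_increment_le_of_deriv_power)
    fix t :: real
    show "(p has_real_derivative g (x + t *\<^sub>R u) \<bullet> u - g x \<bullet> u - t * (H x u \<bullet> u)) (at t)"
      unfolding p_def using f_deriv[OF assms, of t]
      by (auto intro!: derivative_eq_intros)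
    assume t: "0 \<le> t"
    have "g (x + t *\<^sub>R u) \<bullet> u - g x \<bullet> u - t * (H x u \<bullet> u)
      = (g (x + t *\<^sub>R u) - g x - H x (t *\<^sub>R u)) \<bullet> u"
      using assms H_linear[of x] by (simp add: inner_diff_left linear_cmul)
    also have "\<bar>\<dots>\<bar> \<le> L / 2 * (norm (t *\<^sub>R u))\<^sup>2 * norm u"
      using assms V by (intro taylor_gradient) (auto intro: subspace_scale)
    also have "\<dots> = L / 2 * norm u ^ 3 * t ^ 2"
      using t by (simp add: power2_eq_square power3_eq_cube)
    finally show "\<bar>g (x + t *\<^sub>R u) \<bullet> u - g x \<bullet> u - t * (H x u \<bullet> u)\<bar>
      \<le> L / 2 * norm u ^ 3 * t ^ 2" .
  qed
  then show ?thesis by (simp add: p_def inner_commute algebra_simps)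
qed

text \<open>
  Expanding \<open>f (x + t *\<^sub>R u + t *\<^sub>R w)\<close> once about \<open>x\<close> and once about \<open>x + t *\<^sub>R u\<close> and comparing the
  terms of order \<open>t\<^sup>2\<close> gives the symmetry: the first expansion contains only the symmetrised form,
  the second contains \<open>w \<bullet> H x u\<close> through the expansion of the gradient. All remainders are \<open>O(t ^ 3)\<close>.
\<close>
lemma hessian_symmetric:
  assumes x: "x \<in> V" and u: "u \<in> V" and w: "w \<in> V"
  shows "u \<bullet> H x w = w \<bullet> H x u"
proof -
  define a b where "a = norm u" and "b = norm w"
  define K where "K = L * (a\<^sup>2 * b / 2 + a * b\<^sup>2 / 2 + b ^ 3 / 6 + a ^ 3 / 6 + (a + b) ^ 3 / 6)"
  define D where "D = (u \<bullet> H x w - w \<bullet> H x u) / 2"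
  have lin: "H z (p + q) = H z p + H z q" "H z (c *\<^sub>R p) = c *\<^sub>R H z p" if "z \<in> V" for z p q c
    using H_linear[OF that] by (simp_all add: linear_add linear_cmul)
  have key: "t\<^sup>2 * \<bar>D\<bar> \<le> K * t ^ 3" if t: "0 \<le> t" for t
  proof -
    let ?u = "t *\<^sub>R u" and ?w = "t *\<^sub>R w"
    have m: "?u \<in> V" "?w \<in> V" "?u + ?w \<in> V" "x + ?u \<in> V"
      using assms V by (auto intro: subspace_add subspace_scale)
    have t1: "\<bar>f (x + (?u + ?w)) - f x - g x \<bullet> (?u + ?w) - ((?u + ?w) \<bullet> H x (?u + ?w)) / 2\<bar>
        \<le> L / 6 * norm (?u + ?w) ^ 3"
      using taylor_function[OF x m(3)] .
    have "norm (?u + ?w) \<le> t * (a + b)"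
      using norm_triangle_ineq[of ?u ?w] t by (simp add: a_def b_def algebra_simps)
    then have "norm (?u + ?w) ^ 3 \<le> (t * (a + b)) ^ 3"
      by (intro power_mono) auto
    then have t1': "L / 6 * norm (?u + ?w) ^ 3 \<le> L / 6 * (t * (a + b)) ^ 3"
      using L_pos by simp
    have t2: "\<bar>f (x + ?u) - f x - g x \<bullet> ?u - (?u \<bullet> H x ?u) / 2\<bar> \<le> L / 6 * (t * a) ^ 3"
      using taylor_function[OF x m(1)] t by (simp add: a_def)
    have t3: "\<bar>f (x + ?u + ?w) - f (x + ?u) - g (x + ?u) \<bullet> ?w - (?w \<bullet> H (x + ?u) ?w) / 2\<bar>
        \<le> L / 6 * (t * b) ^ 3"
      using taylor_function[OF m(4) m(2)] t by (simp add: b_def)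
    have t4: "\<bar>(g (x + ?u) - g x - H x ?u) \<bullet> ?w\<bar> \<le> L / 2 * (t * a)\<^sup>2 * (t * b)"
      using taylor_gradient[OF x m(1), of ?w] t by (simp add: a_def b_def)
    have "\<bar>?w \<bullet> (H (x + ?u) ?w - H x ?w)\<bar> \<le> norm ?w * (L * norm (x + ?u - x) * norm ?w)"
      using m x by (intro order_trans[OF Cauchy_Schwarz_ineq2] mult_left_mono H_lipschitz) auto
    then have t5: "\<bar>?w \<bullet> (H (x + ?u) ?w - H x ?w)\<bar> \<le> L * (t * a) * (t * b)\<^sup>2"
      using t by (simp add: a_def b_def power2_eq_square mult_ac)
    have "t\<^sup>2 * D = ((?u + ?w) \<bullet> H x (?u + ?w)) / 2 - (?u \<bullet> H x ?u) / 2
        - ?w \<bullet> H x ?u - (?w \<bullet> H x ?w) / 2"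
      using x by (simp add: D_def lin inner_add_left inner_add_right power2_eq_square field_simps)
    also have "\<bar>\<dots>\<bar> \<le> L / 6 * (t * (a + b)) ^ 3 + L / 6 * (t * a) ^ 3 + L / 6 * (t * b) ^ 3
        + L / 2 * (t * a)\<^sup>2 * (t * b) + L * (t * a) * (t * b)\<^sup>2 / 2"
      using t1 t1' t2 t3 t4 t5
      by (simp only: inner_diff_left inner_diff_right inner_add_right add.assoc
          inner_commute[of "H x ?u" ?w])
    also have "\<dots> = K * t ^ 3"
      unfolding K_def by (simp add: power_mult_distrib power2_eq_square power3_eq_cube field_simps)
    finally show ?thesis by (simp add: abs_mult)
  qed
  have "\<bar>D\<bar> \<le> 0"
  proof (rule field_le_epsilon)
    fix e :: real assume e: "e > 0"
    define t where "t = e / (\<bar>K\<bar> + 1)"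
    have t: "t > 0" using e by (simp add: t_def)
    have "\<bar>D\<bar> \<le> K * t"
      using key[of t] t by (simp add: power2_eq_square power3_eq_cube)
    also have "\<dots> \<le> \<bar>K\<bar> * t" using t by (intro mult_right_mono) auto
    also have "\<dots> \<le> e" using e by (simp add: t_def field_simps)
    finally show "\<bar>D\<bar> \<le> 0 + e" by simp
  qed
  then show ?thesis by (simp add: D_def)
qed

definition stationary :: "'a set"
  where "stationary = {x \<in> V. g x = 0 \<and> (\<forall>h\<in>V. 0 \<le> h \<bullet> H x h)}"

definition model :: "real \<Rightarrow> 'a \<Rightarrow> 'a \<Rightarrow> real"
  where "model M x s = g x \<bullet> s + 1 / 2 * (s \<bullet> H x s) + M / 6 * norm s ^ 3"

definition cubic_step :: "real \<Rightarrow> 'a \<Rightarrow> 'a \<Rightarrow> bool"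
  where "cubic_step M x s \<longleftrightarrow> s \<in> V \<and> (\<forall>z\<in>V. model M x s \<le> model M x z)"

lemma H_add: "x \<in> V \<Longrightarrow> H x (p + q) = H x p + H x q"
  and H_diff: "x \<in> V \<Longrightarrow> H x (p - q) = H x p - H x q"
  and H_scaleR: "x \<in> V \<Longrightarrow> H x (c *\<^sub>R p) = c *\<^sub>R H x p"
  and H_zero: "x \<in> V \<Longrightarrow> H x 0 = 0"
  using H_linear[of x] by (simp_all add: linear_add linear_diff linear_cmul linear_0)

text \<open>
  Stationarity of the model at its minimiser. The increment of the model in direction \<open>t *\<^sub>R w\<close> is
  nonnegative and equals \<open>t\<close> times the asserted expression up to \<open>O(t\<^sup>2)\<close>; symmetry of the Hessian
  merges the two mixed terms.
\<close>
lemma cubic_step_first_order: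
  assumes x: "x \<in> V" and s: "cubic_step M x s" and w: "w \<in> V" and M: "0 \<le> M"
  shows "(g x + H x s + (M / 2 * norm s) *\<^sub>R s) \<bullet> w = 0"
proof (rule linear_coeff_zero_of_nonneg[where
      K = "\<bar>w \<bullet> H x w\<bar> / 2 + M / 6 * ((3 * norm s + norm w) * (norm w)\<^sup>2)"])
  fix t :: real assume t: "\<bar>t\<bar> \<le> 1"
  let ?K = "\<bar>w \<bullet> H x w\<bar> / 2 + M / 6 * ((3 * norm s + norm w) * (norm w)\<^sup>2)"
  from s have sV: "s \<in> V" by (simp add: cubic_step_def)
  have "model M x s \<le> model M x (s + t *\<^sub>R w)"
    using s line_in[OF sV w, of t] by (simp add: cubic_step_def)
  then have A: "0 \<le> t * (g x \<bullet> w) + t * (w \<bullet> H x s) + t\<^sup>2 * (w \<bullet> H x w) / 2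
      + M / 6 * (norm (s + t *\<^sub>R w) ^ 3 - norm s ^ 3)"
    using hessian_symmetric[OF x sV w] x
    by (simp add: model_def H_add H_scaleR inner_add_left inner_add_right algebra_simps
        power2_eq_square)
  have B: "M / 6 * (norm (s + t *\<^sub>R w) ^ 3 - norm s ^ 3)
      \<le> M / 6 * (3 * norm s * (s \<bullet> (t *\<^sub>R w)) + (3 * norm s + norm w) * (t\<^sup>2 * (norm w)\<^sup>2))"
  proof (rule mult_left_mono)
    have "norm (t *\<^sub>R w) \<le> norm w" using t by (simp add: mult_left_le_one_le)
    then have "(3 * norm s + norm (t *\<^sub>R w)) * (norm (t *\<^sub>R w))\<^sup>2
      \<le> (3 * norm s + norm w) * (t\<^sup>2 * (norm w)\<^sup>2)"
      by (intro mult_mono) (auto simp: power_mult_distrib)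
    with norm_cube_add_le[of s "t *\<^sub>R w"]
    show "norm (s + t *\<^sub>R w) ^ 3 - norm s ^ 3
      \<le> 3 * norm s * (s \<bullet> (t *\<^sub>R w)) + (3 * norm s + norm w) * (t\<^sup>2 * (norm w)\<^sup>2)"
      by linarith
  qed (use M in auto)
  have C: "t\<^sup>2 * (w \<bullet> H x w) / 2 \<le> t\<^sup>2 * \<bar>w \<bullet> H x w\<bar> / 2"
    by (intro divide_right_mono mult_left_mono) auto
  from A B C have "0 \<le> t * (g x \<bullet> w) + t * (w \<bullet> H x s) + t\<^sup>2 * \<bar>w \<bullet> H x w\<bar> / 2
      + M / 6 * (3 * norm s * (s \<bullet> (t *\<^sub>R w)) + (3 * norm s + norm w) * (t\<^sup>2 * (norm w)\<^sup>2))"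
    by linarith
  also have "\<dots> = t * ((g x + H x s + (M / 2 * norm s) *\<^sub>R s) \<bullet> w) + ?K * t\<^sup>2"
    by (simp add: inner_add_left inner_commute[of "H x s" w] field_simps)
  finally show "0 \<le> t * ((g x + H x s + (M / 2 * norm s) *\<^sub>R s) \<bullet> w) + ?K * t\<^sup>2" .
qed

text \<open>
  Averaging the model over \<open>s + w\<close> and \<open>s - w\<close> cancels the linear terms, so global minimality
  bounds \<open>w \<bullet> H x w\<close> below by minus a sum of cubed norms. Choosing \<open>norm w\<close> equal to \<open>norm s\<close> makes
  this \<open>- O(norm s) * (norm w)\<^sup>2\<close>. The constant is not sharp, but any bound that vanishes with
  \<open>norm s\<close> makes limit points second-order stationary.
\<close>
lemma cubic_step_curvature:
  assumes x: "x \<in> V" and s: "cubic_step M x s" and h: "h \<in> V" and M: "0 \<le> M"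
  shows "- (8 / 3 * M * norm s * (norm h)\<^sup>2) \<le> h \<bullet> H x h"
proof (cases "h = 0")
  case False
  from s have sV: "s \<in> V" by (simp add: cubic_step_def)
  \<comment> \<open>A length \<open>\<tau>\<close> slightly above \<open>norm s\<close> is used in place of \<open>norm s\<close>, to cover \<open>s = 0\<close>,
      where \<open>w\<close> would vanish.\<close>
  have key: "- (8 / 3 * M * (norm h)\<^sup>2) * \<tau> \<le> h \<bullet> H x h" if \<tau>: "norm s \<le> \<tau>" "0 < \<tau>" for \<tau>
  proof -
    define w where "w = (\<tau> / norm h) *\<^sub>R h"
    have nw: "norm w = \<tau>" using False \<tau> by (simp add: w_def)
    have wV: "w \<in> V" using h V by (simp add: w_def subspace_scale)
    have "norm (s + w) \<le> 2 * \<tau>" "norm (s - w) \<le> 2 * \<tau>"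
      using norm_triangle_ineq[of s w] norm_triangle_ineq4[of s w] \<tau> nw by auto
    then have c: "norm (s + w) ^ 3 \<le> 8 * \<tau> ^ 3" "norm (s - w) ^ 3 \<le> 8 * \<tau> ^ 3"
      using power_mono[of "norm (s + w)" "2 * \<tau>" 3] power_mono[of "norm (s - w)" "2 * \<tau>" 3]
      by (simp_all add: power_mult_distrib)
    have "model M x s \<le> model M x (s + w)" "model M x s \<le> model M x (s - w)"
      using s wV sV V by (auto simp: cubic_step_def subspace_add subspace_diff)
    then have "0 \<le> model M x (s + w) + model M x (s - w) - 2 * model M x s" by linarith
    also have "\<dots> = w \<bullet> H x w + M / 6 * (norm (s + w) ^ 3 + norm (s - w) ^ 3 - 2 * norm s ^ 3)"
      using x by (simp add: model_def H_add H_diff inner_add_left inner_add_right inner_diff_left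
          inner_diff_right algebra_simps)
    also have "\<dots> \<le> w \<bullet> H x w + M / 6 * (16 * \<tau> ^ 3)"
    proof (intro add_left_mono mult_left_mono)
      show "norm (s + w) ^ 3 + norm (s - w) ^ 3 - 2 * norm s ^ 3 \<le> 16 * \<tau> ^ 3"
        using c zero_le_power[of "norm s" 3] norm_ge_zero[of s] by linarith
    qed (use M in simp)
    also have "w \<bullet> H x w = (\<tau> / norm h)\<^sup>2 * (h \<bullet> H x h)"
      using x by (simp add: w_def H_scaleR power2_eq_square)
    finally have "0 \<le> (\<tau> / norm h)\<^sup>2 * (h \<bullet> H x h + 8 / 3 * M * \<tau> * (norm h)\<^sup>2)"
      using False by (simp add: field_simps power2_eq_square power3_eq_cube)
    then have "0 \<le> h \<bullet> H x h + 8 / 3 * M * \<tau> * (norm h)\<^sup>2"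
      using \<tau> False by (simp add: zero_le_mult_iff)
    then show ?thesis by (simp add: algebra_simps)
  qed
  have lim: "((\<lambda>\<tau>. - (8 / 3 * M * (norm h)\<^sup>2) * \<tau>) \<longlongrightarrow> - (8 / 3 * M * (norm h)\<^sup>2) * norm s)
      (at_right (norm s))"
    by (intro tendsto_intros)
  have "- (8 / 3 * M * (norm h)\<^sup>2) * norm s \<le> h \<bullet> H x h"
  proof (rule tendsto_upperbound[OF lim])
    show "\<forall>\<^sub>F \<tau> in at_right (norm s). - (8 / 3 * M * (norm h)\<^sup>2) * \<tau> \<le> h \<bullet> H x h"
      using eventually_at_right_less[of "norm s"]
    proof (rule eventually_mono)
      fix \<tau> assume "norm s < \<tau>"
      with norm_ge_zero[of s] show "- (8 / 3 * M * (norm h)\<^sup>2) * \<tau> \<le> h \<bullet> H x h"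
        by (intro key) linarith+
    qed
  qed simp
  then show ?thesis by (simp add: algebra_simps)
qed (use x in \<open>simp add: H_zero\<close>)

text \<open>
  The model at \<open>s\<close> is at most its value 0 at the origin, and it exceeds the second-order Taylor
  polynomial by \<open>M / 6 * norm s ^ 3\<close>, of which the Taylor remainder consumes only the share \<open>L / 6\<close>.
\<close>
lemma cubic_step_descent:
  assumes x: "x \<in> V" and s: "cubic_step M x s"
  shows "f (x + s) \<le> f x - (M - L) / 6 * norm s ^ 3"
proof -
  from s have sV: "s \<in> V" by (simp add: cubic_step_def)
  have "model M x s \<le> model M x 0"
    using s V by (simp add: cubic_step_def subspace_0)
  then have "model M x s \<le> 0" by (simp add: model_def)
  then have "g x \<bullet> s + (s \<bullet> H x s) / 2 \<le> - (M / 6 * norm s ^ 3)" by (simp add: model_def)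
  moreover have "f (x + s) - f x - g x \<bullet> s - (s \<bullet> H x s) / 2 \<le> L / 6 * norm s ^ 3"
    using taylor_function[OF x sV] by (rule abs_le_D1)
  ultimately have "f (x + s) \<le> f x - (M / 6 * norm s ^ 3 - L / 6 * norm s ^ 3)" by linarith
  then show ?thesis by (simp only: diff_divide_distrib left_diff_distrib)
qed

text \<open>
  The first-order condition replaces \<open>g x + H x s\<close>, the linearised gradient at \<open>x + s\<close>, by
  \<open>- (M / 2 * norm s) *\<^sub>R s\<close>; the rest is the Taylor remainder. Testing with \<open>g (x + s)\<close> itself
  keeps the argument inside \<open>V\<close>.
\<close>
lemma cubic_step_gradient:
  assumes x: "x \<in> V" and s: "cubic_step M x s" and M: "0 \<le> M"
  shows "norm (g (x + s)) \<le> (L + M) / 2 * (norm s)\<^sup>2"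
proof -
  from s have sV: "s \<in> V" by (simp add: cubic_step_def)
  let ?w = "g (x + s)"
  have wV: "?w \<in> V" using x sV V by (intro g_in subspace_add)
  have "norm ?w * norm ?w = ?w \<bullet> ?w" by (simp add: norm_eq_sqrt_inner)
  also have "\<dots> = (g (x + s) - g x - H x s) \<bullet> ?w - M / 2 * norm s * (s \<bullet> ?w)"
    using cubic_step_first_order[OF x s wV M] by (simp add: inner_diff_left inner_add_left)
  also have "\<dots> \<le> L / 2 * (norm s)\<^sup>2 * norm ?w + M / 2 * norm s * (norm s * norm ?w)"
  proof -
    have "- (s \<bullet> ?w) \<le> norm s * norm ?w" using Cauchy_Schwarz_ineq2[of s ?w] by linarith
    then have "M / 2 * norm s * (- (s \<bullet> ?w)) \<le> M / 2 * norm s * (norm s * norm ?w)"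
      using M by (intro mult_left_mono) auto
    then show ?thesis using taylor_gradient[OF x sV, of ?w] by (simp add: abs_le_iff)
  qed
  also have "\<dots> = (L + M) / 2 * (norm s)\<^sup>2 * norm ?w"
    by (simp add: power2_eq_square field_simps)
  finally show ?thesis
    using L_pos M by (cases "?w = 0") auto
qed

text \<open>
  Put \<open>e = z - x\<close> and \<open>w = s - e\<close>. Since \<open>g z = 0\<close>, the vector \<open>g x + H x e\<close> is \<open>O((norm e)\<^sup>2)\<close>;
  subtracting it from the first-order condition of \<open>s\<close> and testing with \<open>w\<close> gives
  \<open>w \<bullet> H x w + M / 2 * norm s * (s \<bullet> w) \<le> L / 2 * (norm e)\<^sup>2 * norm w\<close>. The Hessian at \<open>x\<close> is nearly
  positive semidefinite because the one at \<open>z\<close> is, and what remains is a cubic inequality between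
  \<open>norm s\<close> and \<open>norm e\<close>.
\<close>
lemma cubic_step_length:
  assumes x: "x \<in> V" and s: "cubic_step M x s" and z: "z \<in> stationary" and M: "L \<le> M"
  shows "norm s \<le> 5 * norm (x - z)"
proof (rule bounded_by_multiple_of_cubic_ineq[OF _ _ L_pos M])
  from s have sV: "s \<in> V" by (simp add: cubic_step_def)
  define e where "e = z - x"
  from z have zV: "z \<in> V" and gz: "g z = 0" and Hz: "\<And>h. h \<in> V \<Longrightarrow> 0 \<le> h \<bullet> H z h"
    by (auto simp: stationary_def)
  have eV: "e \<in> V" using x zV V by (simp add: e_def subspace_diff)
  have ne: "norm (x - z) = norm e" by (simp add: e_def norm_minus_commute)
  define w where "w = s - e"
  have wV: "w \<in> V" using sV eV V by (simp add: w_def subspace_diff)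
  have nw: "norm w \<le> norm s + norm e" using norm_triangle_ineq4[of s e] by (simp add: w_def)
  have "(g (x + e) - g x - H x e) \<bullet> w = - ((g x + H x e) \<bullet> w)"
    by (simp add: e_def gz inner_diff_left inner_add_left)
  with taylor_gradient[OF x eV, of w]
  have A: "\<bar>(g x + H x e) \<bullet> w\<bar> \<le> L / 2 * (norm e)\<^sup>2 * norm w"
    by (simp only: abs_minus_cancel)
  have B: "(g x + H x s + (M / 2 * norm s) *\<^sub>R s) \<bullet> w = 0"
    using M L_pos by (intro cubic_step_first_order[OF x s wV]) auto
  have "\<bar>w \<bullet> (H x w - H z w)\<bar> \<le> norm w * (L * norm (x - z) * norm w)"
    using x zV wV by (intro order_trans[OF Cauchy_Schwarz_ineq2] mult_left_mono H_lipschitz) auto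
  then have C: "- (L * norm e * (norm w)\<^sup>2) \<le> w \<bullet> H x w"
    using Hz[OF wV] by (simp add: inner_diff_right ne power2_eq_square mult_ac abs_le_iff)
  have "M / 2 * norm s * (s \<bullet> w) = - ((g x + H x e) \<bullet> w) - w \<bullet> H x w"
  proof -
    have "H x s = H x e + H x w" using x by (simp add: w_def H_diff)
    with B show ?thesis by (simp add: inner_add_left inner_commute[of w "H x w"])
  qed
  also have "\<dots> \<le> L / 2 * (norm e)\<^sup>2 * norm w + L * norm e * (norm w)\<^sup>2"
    using A C by linarith
  also have "\<dots> \<le> L / 2 * (norm e)\<^sup>2 * (norm s + norm e) + L * norm e * (norm s + norm e)\<^sup>2"
    using nw L_pos by (intro add_mono mult_left_mono power_mono) auto
  finally have D: "M / 2 * norm s * (s \<bullet> w)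
      \<le> L / 2 * (norm e)\<^sup>2 * (norm s + norm e) + L * norm e * (norm s + norm e)\<^sup>2" .
  have "norm s * (norm s - norm e) \<le> s \<bullet> w"
    using norm_cauchy_schwarz[of s e]
    by (simp add: w_def inner_diff_right algebra_simps flip: power2_norm_eq_inner)
      (simp add: power2_eq_square)
  then have "M / 2 * norm s * (norm s * (norm s - norm e)) \<le> M / 2 * norm s * (s \<bullet> w)"
    using M L_pos by (intro mult_left_mono) auto
  with D show "M / 2 * ((norm s)\<^sup>2 * (norm s - norm (x - z)))
    \<le> L / 2 * (norm (x - z))\<^sup>2 * (norm s + norm (x - z))
      + L * norm (x - z) * (norm s + norm (x - z))\<^sup>2"
    by (simp add: ne power2_eq_square algebra_simps)
qed auto

end


section \<open>Convergence from a quadratically shrinking distance\<close>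

text \<open>
  Once \<open>b * d k \<le> 1 / 2\<close>, the quadratic recursion makes \<open>d\<close> at least halve at every step, so the
  remaining moves are dominated by a geometric series with sum \<open>2 * a * d k\<close>.
\<close>
lemma tail_within_twice_residual:
  fixes x :: "nat \<Rightarrow> 'a::metric_space" and d :: "nat \<Rightarrow> real"
  assumes a: "0 \<le> a" and d0: "\<And>k. 0 \<le> d k" and d: "d \<longlonglongrightarrow> 0"
    and move: "\<forall>\<^sub>F k in sequentially. dist (x (Suc k)) (x k) \<le> a * d k"
    and quad: "\<forall>\<^sub>F k in sequentially. d (Suc k) \<le> b * (d k)\<^sup>2"
  shows "\<forall>\<^sub>F k in sequentially. \<forall>n. dist (x (k + n)) (x k) \<le> 2 * a * d k"
proof -
  have "(\<lambda>k. b * d k) \<longlonglongrightarrow> b * 0" by (intro tendsto_intros d)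
  then have "\<forall>\<^sub>F k in sequentially. b * d k < 1 / 2"
    by (rule order_tendstoD(2)) simp
  with quad have "\<forall>\<^sub>F k in sequentially. d (Suc k) \<le> d k / 2"
  proof eventually_elim
    case (elim k)
    have "b * d k * d k \<le> 1 / 2 * d k"
      using elim(2) d0 by (intro mult_right_mono) auto
    with elim(1) show ?case by (simp add: power2_eq_square mult.assoc)
  qed
  with move have "\<forall>\<^sub>F k in sequentially. dist (x (Suc k)) (x k) \<le> a * d k \<and> d (Suc k) \<le> d k / 2"
    by eventually_elim simp
  then obtain N where N: "\<And>k. N \<le> k \<Longrightarrow> dist (x (Suc k)) (x k) \<le> a * d k"
    and half: "\<And>k. N \<le> k \<Longrightarrow> d (Suc k) \<le> d k / 2"
    by (auto simp: eventually_sequentially)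
  show ?thesis unfolding eventually_sequentially
  proof (intro exI[of _ N] allI impI)
    fix k n assume k: "N \<le> k"
    have geo: "d (k + n) \<le> d k / 2 ^ n" for n
    proof (induction n)
      case (Suc n)
      have "d (k + Suc n) \<le> d (k + n) / 2" using half[of "k + n"] k by simp
      also have "\<dots> \<le> d k / 2 ^ n / 2" using Suc by (intro divide_right_mono) auto
      finally show ?case by (simp add: mult.commute)
    qed simp
    have "dist (x (k + n)) (x k) \<le> 2 * a * d k * (1 - 1 / 2 ^ n)"
    proof (induction n)
      case (Suc n)
      have "dist (x (k + Suc n)) (x k) \<le> dist (x (Suc (k + n))) (x (k + n)) + dist (x (k + n)) (x k)"
        using dist_triangle[of "x (k + Suc n)" "x k" "x (k + n)"] by simp
      also have "\<dots> \<le> a * (d k / 2 ^ n) + 2 * a * d k * (1 - 1 / 2 ^ n)"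
        using N[of "k + n"] k mult_left_mono[OF geo[of n] a] Suc by (intro add_mono) auto
      also have "\<dots> = 2 * a * d k * (1 - 1 / 2 ^ Suc n)"
        by (simp add: field_simps)
      finally show ?case .
    qed simp
    also have "\<dots> \<le> 2 * a * d k * 1"
      using a d0 by (intro mult_left_mono) auto
    finally show "dist (x (k + n)) (x k) \<le> 2 * a * d k" by simp
  qed
qed

lemma Cauchy_of_tail_bound:
  fixes x :: "nat \<Rightarrow> 'a::metric_space"
  assumes c: "c \<longlonglongrightarrow> 0"
    and tail: "\<forall>\<^sub>F k in sequentially. \<forall>n. dist (x (k + n)) (x k) \<le> c k"
  shows "Cauchy x"
proof (rule metric_CauchyI)
  fix e :: real assume "0 < e"
  then have "\<forall>\<^sub>F k in sequentially. c k < e / 2"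
    using c by (intro order_tendstoD(2)) auto
  with tail have "\<forall>\<^sub>F k in sequentially. \<forall>n. dist (x (k + n)) (x k) < e / 2"
    by eventually_elim (blast intro: le_less_trans)
  then obtain N where "\<And>n. dist (x (N + n)) (x N) < e / 2"
    by (auto simp: eventually_sequentially)
  then have "\<And>m. N \<le> m \<Longrightarrow> dist (x m) (x N) < e / 2"
    by (metis le_add_diff_inverse)
  then show "\<exists>M. \<forall>m\<ge>M. \<forall>n\<ge>M. dist (x m) (x n) < e"
    by (meson dist_triangle_half_l)
qed

section \<open>Convergence of the method\<close>

text \<open>
  Of the momentum and monotone steps only two consequences are kept: \<open>x (Suc k)\<close> has function value
  at most that of \<open>y (Suc k)\<close>, and it deviates from \<open>y (Suc k)\<close> by at most the new gradient norm
  times the last displacement of \<open>y\<close>. They hold whichever of the two candidates is selected.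
\<close>
locale cubic_momentum_iteration = lipschitz_hessian +
  fixes M \<kappa> r :: real and x y s :: "nat \<Rightarrow> 'a"
  assumes compact_balls: "\<And>R. compact (V \<inter> cball 0 R)"
    and g_continuous: "continuous_on V g"
    and f_below: "bdd_below (f ` V)"
    and sublevel_bounded: "\<And>\<alpha>. bounded {z \<in> V. f z \<le> \<alpha>}"
    and M: "L < M" and \<kappa>: "0 < \<kappa>" and r: "0 < r"
    and error_bound: "\<And>z. z \<in> V \<Longrightarrow> infdist z stationary \<le> r \<Longrightarrow>
      infdist z stationary \<le> \<kappa> * norm (g z)"
    and x_in: "\<And>k. x k \<in> V"
    and start: "y 0 = x 0"
    and step: "\<And>k. cubic_step M (x k) (s (Suc k))"
    and y_Suc: "\<And>k. y (Suc k) = x k + s (Suc k)"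
    and momentum: "\<And>k. norm (x (Suc k) - y (Suc k))
      \<le> norm (g (y (Suc k))) * norm (y (Suc k) - y k)"
    and monotone: "\<And>k. f (x (Suc k)) \<le> f (y (Suc k))"
begin

lemma M_pos: "0 < M"
  using L_pos M by linarith

lemma y_in: "y k \<in> V"
  using x_in start y_Suc step V by (cases k) (auto simp: cubic_step_def subspace_add)

lemma y_descent: "f (y (Suc k)) \<le> f (x k) - (M - L) / 6 * norm (s (Suc k)) ^ 3"
  unfolding y_Suc by (rule cubic_step_descent[OF x_in step])

lemma f_y_le_f_x: "f (y (Suc k)) \<le> f (x k)"
proof -
  have "0 \<le> (M - L) / 6 * norm (s (Suc k)) ^ 3" using M by simp
  with y_descent[of k] show ?thesis by linarith
qed

lemma f_decreasing: "decseq (\<lambda>k. f (x k))"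
  using order_trans[OF monotone f_y_le_f_x] by (auto intro: decseq_SucI)

text \<open>
  The values \<open>f (x k)\<close> decrease to a limit, so their increments tend to 0, and these dominate the
  cubed step lengths.
\<close>
lemma steps_vanish: "(\<lambda>k. norm (s (Suc k))) \<longlonglongrightarrow> 0"
proof -
  obtain B where B: "\<And>z. z \<in> V \<Longrightarrow> B \<le> f z"
    using f_below by (auto simp: bdd_below_def)
  obtain l where l: "(\<lambda>k. f (x k)) \<longlonglongrightarrow> l"
    using decseq_convergent[OF f_decreasing, of B] B x_in by blast
  have "(\<lambda>k. f (x k) - f (x (Suc k))) \<longlonglongrightarrow> l - l"
    by (intro tendsto_diff l LIMSEQ_Suc)
  then have lim: "(\<lambda>k. 6 / (M - L) * (f (x k) - f (x (Suc k)))) \<longlonglongrightarrow> 0"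
    using tendsto_mult_right_zero by fastforce
  have "(\<lambda>k. norm (s (Suc k)) ^ 3) \<longlonglongrightarrow> 0"
  proof (rule tendsto_sandwich[OF _ _ tendsto_const lim])
    show "\<forall>\<^sub>F k in sequentially. norm (s (Suc k)) ^ 3 \<le> 6 / (M - L) * (f (x k) - f (x (Suc k)))"
    proof (intro always_eventually allI)
      fix k
      have "(M - L) / 6 * norm (s (Suc k)) ^ 3 \<le> f (x k) - f (x (Suc k))"
        using y_descent[of k] monotone[of k] by linarith
      then show "norm (s (Suc k)) ^ 3 \<le> 6 / (M - L) * (f (x k) - f (x (Suc k)))"
        using M by (simp add: field_simps)
    qed
  qed simp
  then show ?thesis by (simp add: power_tendsto_0_iff)
qed

lemma iterates_bounded: "\<exists>R. \<forall>k. x k \<in> V \<inter> cball 0 R \<and> y k \<in> V \<inter> cball 0 R"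
proof -
  obtain R where R: "\<And>z. z \<in> V \<Longrightarrow> f z \<le> f (x 0) \<Longrightarrow> norm z \<le> R"
    using sublevel_bounded[of "f (x 0)"] by (auto simp: bounded_iff)
  have fx: "f (x k) \<le> f (x 0)" for k
    using decseqD[OF f_decreasing, of 0 k] by simp
  have "f (y k) \<le> f (x 0)" for k
    using start fx f_y_le_f_x order_trans by (cases k) (simp, blast)
  with fx R x_in y_in show ?thesis by (intro exI[of _ R]) auto
qed

lemma gradient_le: "norm (g (y (Suc k))) \<le> (L + M) / 2 * (norm (s (Suc k)))\<^sup>2"
  unfolding y_Suc using M_pos by (intro cubic_step_gradient x_in step) simp

lemma gradients_vanish: "(\<lambda>k. norm (g (y (Suc k)))) \<longlonglongrightarrow> 0"
proof (rule tendsto_sandwich[OF _ _ tendsto_const])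
  show "(\<lambda>k. (L + M) / 2 * (norm (s (Suc k)))\<^sup>2) \<longlonglongrightarrow> 0"
    by (rule tendsto_eq_intros steps_vanish refl | simp)+
  show "\<forall>\<^sub>F k in sequentially. norm (g (y (Suc k))) \<le> (L + M) / 2 * (norm (s (Suc k)))\<^sup>2"
    by (intro always_eventually allI gradient_le)
qed simp

lemma momentum_vanishes: "(\<lambda>k. norm (x k - y k)) \<longlonglongrightarrow> 0"
proof -
  obtain R where R: "\<And>k. norm (y k) \<le> R"
    using iterates_bounded by auto
  have "(\<lambda>k. norm (x (Suc k) - y (Suc k))) \<longlonglongrightarrow> 0"
  proof (rule tendsto_sandwich[OF _ _ tendsto_const])
    show "(\<lambda>k. norm (g (y (Suc k))) * (R + R)) \<longlonglongrightarrow> 0"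
      by (rule tendsto_mult_left_zero[OF gradients_vanish])
    have "norm (x (Suc k) - y (Suc k)) \<le> norm (g (y (Suc k))) * (R + R)" for k
      using R by (intro order_trans[OF momentum] mult_left_mono order_trans[OF norm_triangle_ineq4]
          add_mono) auto
    then show "\<forall>\<^sub>F k in sequentially. norm (x (Suc k) - y (Suc k)) \<le> norm (g (y (Suc k))) * (R + R)"
      by (simp add: always_eventually)
  qed simp
  then show ?thesis by (rule LIMSEQ_imp_Suc)
qed

text \<open>
  The gradient is small at \<open>y (Suc (q k)) = x (q k) + s (Suc (q k))\<close>, which has the same limit as
  \<open>x (q k)\<close>, while the curvature bound is available at \<open>x (q k)\<close> itself; both pass to the limit.
\<close>
lemma limit_points_stationary:
  assumes q: "strict_mono q" and lim: "(\<lambda>k. x (q k)) \<longlonglongrightarrow> z" and z: "z \<in> V"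
  shows "z \<in> stationary"
proof -
  have sq: "(\<lambda>k. norm (s (Suc (q k)))) \<longlonglongrightarrow> 0"
    using LIMSEQ_subseq_LIMSEQ[OF steps_vanish q] by (simp add: o_def)
  have "(\<lambda>k. x (q k) + s (Suc (q k))) \<longlonglongrightarrow> z + 0"
    by (intro tendsto_add lim) (use sq in \<open>simp add: tendsto_norm_zero_iff\<close>)
  then have "(\<lambda>k. y (Suc (q k))) \<longlonglongrightarrow> z" by (simp add: y_Suc)
  then have "(\<lambda>k. g (y (Suc (q k)))) \<longlonglongrightarrow> g z"
    using g_continuous z y_in by (auto simp: continuous_on_sequentially o_def)
  moreover have "(\<lambda>k. g (y (Suc (q k)))) \<longlonglongrightarrow> 0"
    using LIMSEQ_subseq_LIMSEQ[OF gradients_vanish q] by (simp add: o_def tendsto_norm_zero_iff)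
  ultimately have "g z = 0" by (rule LIMSEQ_unique)
  moreover have "0 \<le> h \<bullet> H z h" if h: "h \<in> V" for h
  proof -
    have "- (8 / 3 * M * norm (s (Suc (q k))) * (norm h)\<^sup>2) - norm h * (L * norm (x (q k) - z) * norm h)
        \<le> h \<bullet> H z h" for k
    proof -
      have "\<bar>h \<bullet> (H (x (q k)) h - H z h)\<bar> \<le> norm h * (L * norm (x (q k) - z) * norm h)"
        using h z x_in
        by (intro order_trans[OF Cauchy_Schwarz_ineq2] mult_left_mono H_lipschitz) auto
      moreover have "- (8 / 3 * M * norm (s (Suc (q k))) * (norm h)\<^sup>2) \<le> h \<bullet> H (x (q k)) h"
        using M_pos by (intro cubic_step_curvature x_in step h) simp
      ultimately show ?thesis by (simp add: inner_diff_right abs_le_iff)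
    qed
    moreover have "(\<lambda>k. - (8 / 3 * M * norm (s (Suc (q k))) * (norm h)\<^sup>2)
        - norm h * (L * norm (x (q k) - z) * norm h))
      \<longlonglongrightarrow> - (8 / 3 * M * 0 * (norm h)\<^sup>2) - norm h * (L * norm (z - z) * norm h)"
      by (intro tendsto_intros sq lim)
    ultimately show ?thesis
      by (intro LIMSEQ_le_const2) auto
  qed
  ultimately show ?thesis using z by (simp add: stationary_def)
qed

lemma subsequence_to_stationary:
  fixes p :: "nat \<Rightarrow> nat"
  assumes "strict_mono p"
  obtains q z where "strict_mono q" "z \<in> stationary" "(\<lambda>k. x (p (q k))) \<longlonglongrightarrow> z"
proof -
  obtain R where R: "\<And>k. x k \<in> V \<inter> cball 0 R"
    using iterates_bounded by blast
  then obtain z q where z: "z \<in> V \<inter> cball 0 R" and q: "strict_mono q"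
    and lim: "((\<lambda>k. x (p k)) \<circ> q) \<longlonglongrightarrow> z"
    using seq_compactE[OF compact_imp_seq_compact[OF compact_balls[of R]], of "\<lambda>k. x (p k)"] by blast
  have "z \<in> stationary"
    using z q assms lim
    by (intro limit_points_stationary[of "\<lambda>k. p (q k)"]) (auto simp: strict_mono_def o_def)
  with that[OF q] lim show ?thesis by (simp add: o_def)
qed

lemma stationary_nonempty: "stationary \<noteq> {}"
  by (rule subsequence_to_stationary[of "\<lambda>k. k"]) (auto simp: strict_mono_def)

lemma distances_vanish: "(\<lambda>k. infdist (x k) stationary) \<longlonglongrightarrow> 0"
proof (rule ccontr)
  assume "\<not> ?thesis"
  then obtain e where e: "0 < e" "\<not> (\<forall>\<^sub>F k in sequentially. infdist (x k) stationary < e)"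
    by (auto simp: tendsto_iff infdist_nonneg)
  then have "infinite {k. e \<le> infdist (x k) stationary}"
    by (simp add: not_less flip: cofinite_eq_sequentially add: eventually_cofinite)
  then obtain p :: "nat \<Rightarrow> nat" where p: "strict_mono p" "\<And>k. e \<le> infdist (x (p k)) stationary"
    using infinite_enumerate by blast
  obtain q z where z: "z \<in> stationary" and lim: "(\<lambda>k. x (p (q k))) \<longlonglongrightarrow> z"
    using subsequence_to_stationary[OF p(1)] .
  have "\<forall>\<^sub>F k in sequentially. dist (x (p (q k))) z < e"
    using lim e(1) by (rule tendstoD)
  then obtain k where "dist (x (p (q k))) z < e"
    by (auto simp: eventually_sequentially)
  with infdist_le[OF z, of "x (p (q k))"] p(2)[of "q k"] show False by linarith
qed

lemma step_le_distance: "norm (s (Suc k)) \<le> 5 * infdist (x k) stationary"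
proof -
  have "norm (s (Suc k)) / 5 \<le> dist (x k) z" if "z \<in> stationary" for z
    using cubic_step_length[OF x_in step that, of k] M by (simp add: dist_norm)
  then have "norm (s (Suc k)) / 5 \<le> infdist (x k) stationary"
    unfolding infdist_notempty[OF stationary_nonempty]
    by (intro cINF_greatest stationary_nonempty)
  then show ?thesis by simp
qed

text \<open>
  The displacement \<open>y (Suc k) - y k = (x k - y k) + s (Suc k)\<close> tends to 0, hence is eventually at most
  1, and the momentum is then bounded by the gradient norm alone.
\<close>
lemma eventually_momentum_le:
  "\<forall>\<^sub>F k in sequentially. norm (x (Suc k) - y (Suc k)) \<le> (L + M) / 2 * (norm (s (Suc k)))\<^sup>2"
proof -
  have "(\<lambda>k. norm (x k - y k) + norm (s (Suc k))) \<longlonglongrightarrow> 0 + 0"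
    by (intro tendsto_add momentum_vanishes steps_vanish)
  then have "\<forall>\<^sub>F k in sequentially. norm (x k - y k) + norm (s (Suc k)) < 1"
    by (rule order_tendstoD(2)) simp
  then show ?thesis
  proof eventually_elim
    case (elim k)
    have "y (Suc k) - y k = (x k - y k) + s (Suc k)" by (simp add: y_Suc)
    then have "norm (y (Suc k) - y k) \<le> 1"
      using norm_triangle_ineq[of "x k - y k" "s (Suc k)"] elim
      by (simp only:)
    then have "norm (g (y (Suc k))) * norm (y (Suc k) - y k) \<le> norm (g (y (Suc k)))"
      by (simp add: mult_left_le)
    with momentum[of k] gradient_le[of k] show ?case by linarith
  qed
qed

lemma eventually_move_le:
  "\<forall>\<^sub>F k in sequentially. dist (x (Suc k)) (x k) \<le> 10 * infdist (x k) stationary"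
proof -
  have "(\<lambda>k. (L + M) / 2 * norm (s (Suc k))) \<longlonglongrightarrow> 0"
    by (rule tendsto_mult_right_zero[OF steps_vanish])
  then have "\<forall>\<^sub>F k in sequentially. (L + M) / 2 * norm (s (Suc k)) < 1"
    by (rule order_tendstoD(2)) simp
  with eventually_momentum_le show ?thesis
  proof eventually_elim
    case (elim k)
    have "(L + M) / 2 * norm (s (Suc k)) * norm (s (Suc k)) \<le> 1 * norm (s (Suc k))"
      using elim(2) by (intro mult_right_mono) auto
    with elim(1) have "norm (x (Suc k) - y (Suc k)) \<le> norm (s (Suc k))"
      by (simp add: power2_eq_square mult.assoc)
    moreover have "x (Suc k) - x k = (x (Suc k) - y (Suc k)) + s (Suc k)" by (simp add: y_Suc)
    then have "dist (x (Suc k)) (x k) \<le> norm (x (Suc k) - y (Suc k)) + norm (s (Suc k))"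
      using norm_triangle_ineq[of "x (Suc k) - y (Suc k)" "s (Suc k)"] by (simp only: dist_norm)
    ultimately show ?case using step_le_distance[of k] by linarith
  qed
qed

text \<open>
  The error bound controls the distance from \<open>y (Suc k)\<close> by \<open>\<kappa>\<close> times its gradient norm, and momentum
  adds at most one more gradient bound, whence \<open>\<kappa> + 1\<close>. The radius \<open>r\<close> decides from which
  \<open>k\<close> on the error bound applies.
\<close>
lemma eventually_distance_quadratic:
  "\<forall>\<^sub>F k in sequentially. infdist (x (Suc k)) stationary
    \<le> 25 * (\<kappa> + 1) * ((L + M) / 2) * (infdist (x k) stationary)\<^sup>2"
proof -
  have "(\<lambda>k. infdist (x k) stationary + norm (s (Suc k))) \<longlonglongrightarrow> 0 + 0"
    by (intro tendsto_add distances_vanish steps_vanish)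
  then have "\<forall>\<^sub>F k in sequentially. infdist (x k) stationary + norm (s (Suc k)) < r"
    by (rule order_tendstoD(2)) (use r in simp)
  with eventually_momentum_le show ?thesis
  proof eventually_elim
    case (elim k)
    let ?A = "(L + M) / 2"
    have "infdist (y (Suc k)) stationary \<le> infdist (x k) stationary + norm (s (Suc k))"
      using infdist_triangle[of "y (Suc k)" stationary "x k"] by (simp add: y_Suc dist_norm)
    with elim(2) have "infdist (y (Suc k)) stationary \<le> \<kappa> * norm (g (y (Suc k)))"
      by (intro error_bound y_in) simp
    also have "\<dots> \<le> \<kappa> * (?A * (norm (s (Suc k)))\<^sup>2)"
      using \<kappa> gradient_le by (intro mult_left_mono) auto
    finally have "infdist (x (Suc k)) stationary \<le> (\<kappa> + 1) * ?A * (norm (s (Suc k)))\<^sup>2"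
      using infdist_triangle[of "x (Suc k)" stationary "y (Suc k)"] elim(1)
      by (simp add: dist_norm algebra_simps)
    also have "\<dots> \<le> (\<kappa> + 1) * ?A * (5 * infdist (x k) stationary)\<^sup>2"
      using \<kappa> L_pos M_pos step_le_distance by (intro mult_left_mono power_mono) auto
    also have "\<dots> = 25 * (\<kappa> + 1) * ?A * (infdist (x k) stationary)\<^sup>2"
      by (simp add: power_mult_distrib)
    finally show ?case .
  qed
qed

theorem converges_quadratically:
  "\<exists>z\<in>stationary. x \<longlonglongrightarrow> z \<and>
    (\<forall>\<^sub>F k in sequentially. norm (x (Suc k) - z) \<le> 250 * (\<kappa> + 1) * (L + M) * (norm (x k - z))\<^sup>2)"
proof -
  let ?d = "\<lambda>k. infdist (x k) stationary"
  have tail: "\<forall>\<^sub>F k in sequentially. \<forall>n. dist (x (k + n)) (x k) \<le> 2 * 10 * ?d k"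
    by (rule tail_within_twice_residual[OF _ _ distances_vanish eventually_move_le
          eventually_distance_quadratic]) (auto simp: infdist_nonneg)
  have "Cauchy x"
    by (rule Cauchy_of_tail_bound[OF _ tail]) (rule tendsto_mult_right_zero[OF distances_vanish])
  moreover obtain R where "\<forall>k. x k \<in> V \<inter> cball 0 R"
    using iterates_bounded by blast
  ultimately obtain z where z: "z \<in> V" and lim: "x \<longlonglongrightarrow> z"
    using completeE[OF compact_imp_complete[OF compact_balls[of R]], of x] by blast
  have zS: "z \<in> stationary"
    using z lim by (intro limit_points_stationary[of "\<lambda>k. k"]) (auto simp: strict_mono_def)
  have near: "\<forall>\<^sub>F k in sequentially. norm (x k - z) \<le> 20 * ?d k"
    using tail
  proof eventually_elim
    case (elim k)
    have "(\<lambda>n. dist (x (n + k)) (x k)) \<longlonglongrightarrow> dist z (x k)"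
      by (intro tendsto_intros LIMSEQ_ignore_initial_segment lim)
    then have "dist z (x k) \<le> 2 * 10 * ?d k"
      using elim by (intro LIMSEQ_le_const2) (auto simp: add.commute)
    then show ?case by (simp add: dist_norm norm_minus_commute)
  qed
  have "\<forall>\<^sub>F k in sequentially. norm (x (Suc k) - z) \<le> 20 * ?d (Suc k)"
    using near by (rule eventually_sequentially_Suc[THEN iffD2])
  with eventually_distance_quadratic
  have "\<forall>\<^sub>F k in sequentially.
      norm (x (Suc k) - z) \<le> 250 * (\<kappa> + 1) * (L + M) * (norm (x k - z))\<^sup>2"
  proof eventually_elim
    case (elim k)
    have "?d k \<le> norm (x k - z)" using infdist_le[OF zS] by (simp add: dist_norm)
    then have "250 * (\<kappa> + 1) * (L + M) * (?d k)\<^sup>2 \<le> 250 * (\<kappa> + 1) * (L + M) * (norm (x k - z))\<^sup>2"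
      using \<kappa> L_pos M_pos by (intro mult_left_mono power_mono) (auto simp: infdist_nonneg)
    moreover have "20 * (25 * (\<kappa> + 1) * ((L + M) / 2) * (?d k)\<^sup>2) = 250 * (\<kappa> + 1) * (L + M) * (?d k)\<^sup>2"
      by simp
    ultimately show ?case using elim by linarith
  qed
  with zS lim show ?thesis by blast
qed

end

section \<open>Instantiation to Euclidean spaces\<close>

lemma norm_lookup_le: "\<bar>Poly_Mapping.lookup z i\<bar> \<le> norm z"
  for z :: "nat \<Rightarrow>\<^sub>0 real"
proof -
  have "Poly_Mapping.single i 1 \<bullet> z = Poly_Mapping.lookup z i"
    by (simp add: inner_poly_mapping_def lookup_single)
  moreover have "norm (Poly_Mapping.single i (1::real)) = 1"
    by (simp add: norm_eq_sqrt_inner inner_poly_mapping_def lookup_single)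
  ultimately show ?thesis
    using Cauchy_Schwarz_ineq2[of "Poly_Mapping.single i 1" z] by simp
qed

text \<open>
  By induction on the dimension: splitting off the last coordinate exhibits the ball as a closed part of
  the continuous image of a product of a lower-dimensional ball and an interval. The radius \<open>2 * R\<close>
  comes from the triangle inequality applied to the vector with that coordinate removed.
\<close>
lemma compact_euclid_cball: "compact (euclid d \<inter> cball 0 R)"
proof (induction d arbitrary: R)
  case 0
  have "euclid 0 = {0}"
    by (auto simp: euclid_def intro!: poly_mapping_eqI)
  then show ?case by (cases "0 \<le> R") auto
next
  case (Suc d)
  let ?e = "Poly_Mapping.single d (1::real)"
  let ?j = "\<lambda>(z :: nat \<Rightarrow>\<^sub>0 real, t). z + t *\<^sub>R ?e"
  have le: "norm ?e = 1"
    by (simp add: norm_eq_sqrt_inner inner_poly_mapping_def lookup_single)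
  have "compact (?j ` ((euclid d \<inter> cball 0 (2 * R)) \<times> cball 0 R) \<inter> cball 0 R)"
    by (intro compact_Int_closed compact_continuous_image compact_Times Suc)
      (auto intro!: continuous_intros simp: case_prod_unfold)
  moreover have "?j ` ((euclid d \<inter> cball 0 (2 * R)) \<times> cball 0 R) \<inter> cball 0 R
      = euclid (Suc d) \<inter> cball 0 R"
  proof (intro equalityI subsetI)
    fix z assume z: "z \<in> euclid (Suc d) \<inter> cball 0 R"
    define t where "t = Poly_Mapping.lookup z d"
    have t: "\<bar>t\<bar> \<le> R" using norm_lookup_le[of z d] z by (simp add: t_def)
    have "norm (z - t *\<^sub>R ?e) \<le> 2 * R"
      using norm_triangle_ineq4[of z "t *\<^sub>R ?e"] z t le by simp
    moreover have "z - t *\<^sub>R ?e \<in> euclid d"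
      using z by (auto simp: euclid_def t_def lookup_minus scaleR_poly_mapping.rep_eq lookup_single
          when_def Suc_le_eq)
    moreover have "z = ?j (z - t *\<^sub>R ?e, t)" by simp
    ultimately show "z \<in> ?j ` ((euclid d \<inter> cball 0 (2 * R)) \<times> cball 0 R) \<inter> cball 0 R"
      using t z by (intro IntI image_eqI) auto
  qed (auto simp: euclid_def lookup_add scaleR_poly_mapping.rep_eq lookup_single when_def)
  ultimately show ?case by simp
qed

lemma has_derivative_along_line:
  fixes F :: "(nat \<Rightarrow>\<^sub>0 real) \<Rightarrow> 'b::real_normed_vector"
  assumes F: "\<And>z. z \<in> euclid d \<Longrightarrow> (F has_derivative D z) (at z within euclid d)"
    and x: "x \<in> euclid d" and u: "u \<in> euclid d"
  shows "((\<lambda>t. F (x + t *\<^sub>R u)) has_derivative (\<lambda>h. D (x + t *\<^sub>R u) (h *\<^sub>R u))) (at t)"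
proof -
  let ?l = "\<lambda>t::real. x + t *\<^sub>R u"
  have sub: "range ?l \<subseteq> euclid d"
    using x u subspace_euclid[of d] by (auto intro: subspace_add subspace_scale)
  have l: "(?l has_derivative (\<lambda>h. h *\<^sub>R u)) (at t)"
    by (auto intro!: derivative_eq_intros)
  have "(F has_derivative D (?l t)) (at (?l t) within range ?l)"
    using sub by (intro has_derivative_subset[OF F sub]) auto
  from diff_chain_within[OF l this] show ?thesis by (simp add: o_def)
qed

lemma norm_le_opnorm:
  assumes A: "bounded_linear A" and h: "h \<in> euclid d"
  shows "norm (A h) \<le> opnorm d A * norm h"
proof -
  obtain K where K: "\<And>z. norm (A z) \<le> norm z * K"
    using bounded_linear.bounded[OF A] by blast
  have "norm (A z) / norm z \<le> \<bar>K\<bar>" for z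
    using order_trans[OF K[of z] mult_left_mono[OF abs_ge_self norm_ge_zero]]
    by (cases "z = 0") (simp_all add: pos_divide_le_eq mult.commute)
  then have "bdd_above ((\<lambda>z. norm (A z) / norm z) ` euclid d)"
    by (intro bdd_aboveI2)
  then have "norm (A h) / norm h \<le> opnorm d A"
    unfolding opnorm_def using h by (intro cSUP_upper)
  then show ?thesis
    using linear_0[OF bounded_linear.linear[OF A]] by (cases "h = 0") (auto simp: field_simps)
qed

lemma assumption_A_imp_lipschitz_hessian:
  assumes A: "assumption_A d L1 L2 f" and L2: "0 < L2"
  shows "lipschitz_hessian (euclid d) f (grad d f) (hess d f) L2"
proof (rule lipschitz_hessian.intro)
  have df: "f differentiable (at z within euclid d)"
    and dg: "(grad d f has_derivative hess d f z) (at z within euclid d)" if "z \<in> euclid d" for z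
    using A that
    by (auto simp: assumption_A_def C2_on_euclid_def differentiable_on_def hess_def
        frechet_derivative_works)
  have bl: "bounded_linear (hess d f z)" if "z \<in> euclid d" for z
    using dg[OF that] by (rule has_derivative_bounded_linear)
  show "subspace (euclid d)" by (rule subspace_euclid)
  show "0 < L2" by (rule L2)
  show "grad d f z \<in> euclid d" if "z \<in> euclid d" for z
    using grad_works(1)[OF that df[OF that]] .
  show "linear (hess d f z)" if "z \<in> euclid d" for z
    using bl[OF that] by (rule bounded_linear.linear)
  show "norm (hess d f x h - hess d f y h) \<le> L2 * norm (x - y) * norm h"
    if x: "x \<in> euclid d" and y: "y \<in> euclid d" and h: "h \<in> euclid d" for x y h
  proof -
    have "norm (hess d f x h - hess d f y h) \<le> opnorm d (\<lambda>h. hess d f x h - hess d f y h) * norm h"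
      by (intro norm_le_opnorm bounded_linear_sub bl x y h)
    also have "\<dots> \<le> L2 * norm (x - y) * norm h"
      using A x y by (intro mult_right_mono) (auto simp: assumption_A_def dist_norm)
    finally show ?thesis .
  qed
  fix x u w :: "nat \<Rightarrow>\<^sub>0 real" and t :: real assume xu: "x \<in> euclid d" "u \<in> euclid d"
  show "((\<lambda>t. f (x + t *\<^sub>R u)) has_real_derivative grad d f (x + t *\<^sub>R u) \<bullet> u) (at t)"
    by (rule has_derivative_imp_has_field_derivative
        [OF has_derivative_along_line[OF grad_works(2)[OF _ df] xu]]) simp_all
  have "x + t *\<^sub>R u \<in> euclid d"
    using xu subspace_euclid[of d] by (auto intro: subspace_add subspace_scale)
  then have lin: "linear (hess d f (x + t *\<^sub>R u))" using bl by (auto intro: bounded_linear.linear)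
  show "((\<lambda>t. grad d f (x + t *\<^sub>R u) \<bullet> w) has_real_derivative hess d f (x + t *\<^sub>R u) u \<bullet> w) (at t)"
    by (rule has_derivative_imp_has_field_derivative
        [OF has_derivative_inner_left[OF has_derivative_along_line[OF dg xu]]])
      (simp_all add: linear_cmul[OF lin])
qed

lemma CRm_sequence_imp_cubic_momentum_iteration:
  assumes A: "assumption_A d L1 L2 f" and L2: "0 < L2" and M: "L2 < M" and \<rho>: "0 \<le> \<rho>"
    and \<kappa>: "0 < \<kappa>" and r: "0 < r" and eb: "local_error_bound d f \<kappa> r"
    and seq: "CRm_sequence d f M \<rho> x0 x"
  shows "\<exists>y s. cubic_momentum_iteration (euclid d) f (grad d f) (hess d f) L2 M \<kappa> r x y s"
proof -
  interpret lipschitz_hessian "euclid d" f "grad d f" "hess d f" L2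
    by (rule assumption_A_imp_lipschitz_hessian[OF A L2])
  have st: "second_order_stationary d f = stationary"
    by (simp add: second_order_stationary_def stationary_def)
  have cs: "cubic_step M z w \<longleftrightarrow> is_arg_min (cubic_model d f M z) (\<lambda>z. z \<in> euclid d) w" for z w
    by (auto simp: cubic_step_def is_arg_min_linorder cubic_model_def model_def)
  from seq obtain y s v \<beta> where x0: "x 0 = x0" "y 0 = x0" "x0 \<in> euclid d"
    and step: "\<And>k. cubic_step M (x k) (s (Suc k))"
    and y: "\<And>k. y (Suc k) = x k + s (Suc k)"
    and \<beta>: "\<And>k. \<beta> (Suc k) = Min {\<rho>, norm (grad d f (y (Suc k))), norm (y (Suc k) - x k)}"
    and v: "\<And>k. v (Suc k) = y (Suc k) + \<beta> (Suc k) *\<^sub>R (y (Suc k) - y k)"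
    and x: "\<And>k. is_arg_min f (\<lambda>z. z \<in> {y (Suc k), v (Suc k)}) (x (Suc k))"
    unfolding CRm_sequence_def cs by blast
  have xyv: "x (Suc k) = y (Suc k) \<or> x (Suc k) = v (Suc k)"
    and mono: "f (x (Suc k)) \<le> f (y (Suc k))" for k
    using x[of k] by (auto simp: is_arg_min_linorder)
  have \<beta>_bounds: "0 \<le> \<beta> (Suc k)" "\<beta> (Suc k) \<le> norm (grad d f (y (Suc k)))" for k
    using \<rho> by (auto simp: \<beta>)
  have "x k \<in> euclid d \<and> y k \<in> euclid d" for k
  proof (induction k)
    case (Suc k)
    then have "y (Suc k) \<in> euclid d"
      using step[of k] V by (auto simp: y cubic_step_def subspace_add)
    moreover from this Suc have "v (Suc k) \<in> euclid d"
      using V by (auto simp: v intro: subspace_add subspace_scale subspace_diff)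
    ultimately show ?case using xyv[of k] by auto
  qed (use x0 in auto)
  then have x_in: "x k \<in> euclid d" for k by simp
  have "cubic_momentum_iteration (euclid d) f (grad d f) (hess d f) L2 M \<kappa> r x y s"
  proof
    show "compact (euclid d \<inter> cball 0 R)" for R by (rule compact_euclid_cball)
    show "continuous_on (euclid d) (grad d f)"
      using A by (auto simp: assumption_A_def intro: lipschitz_on_continuous_on)
    show "bdd_below (f ` euclid d)" "bounded {z \<in> euclid d. f z \<le> \<alpha>}" for \<alpha>
      using A by (auto simp: assumption_A_def)
    show "infdist z stationary \<le> \<kappa> * norm (grad d f z)"
      if "z \<in> euclid d" "infdist z stationary \<le> r" for z
      using eb that by (auto simp: local_error_bound_def st)
    show "norm (x (Suc k) - y (Suc k)) \<le> norm (grad d f (y (Suc k))) * norm (y (Suc k) - y k)" for k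
      using xyv[of k] \<beta>_bounds[of k] by (auto simp: v intro!: mult_right_mono)
  qed (use M \<kappa> r x_in x0 step y mono in auto)
  then show ?thesis by blast
qed

theorem theorem2:
  fixes L1 L2 M \<rho> \<kappa> \<Delta> :: real
  assumes "L1 > 0" and "L2 > 0" and "M > L2" and "0 \<le> \<rho>" and "\<rho> < 1"
    and "\<kappa> > 0" and "\<Delta> \<ge> 0"
  shows "\<exists>C>0. \<forall>(d::nat) (f :: (nat \<Rightarrow>\<^sub>0 real) \<Rightarrow> real) r x0 x.
    assumption_A d L1 L2 f \<longrightarrow>
    r > 0 \<longrightarrow> local_error_bound d f \<kappa> r \<longrightarrow>
    x0 \<in> euclid d \<longrightarrow> f x0 - fstar d f = \<Delta> \<longrightarrow>
    CRm_sequence d f M \<rho> x0 x \<longrightarrow>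
    (\<exists>xs \<in> second_order_stationary d f. x \<longlonglongrightarrow> xs \<and>
      (\<exists>k1. \<forall>k\<ge>k1. norm (x (Suc k) - xs) \<le> C * (norm (x k - xs))\<^sup>2))"
proof (intro exI[of _ "250 * (\<kappa> + 1) * (L2 + M)"] conjI allI impI)
  show "0 < 250 * (\<kappa> + 1) * (L2 + M)" using assms by simp
next
  fix d :: nat and f :: "(nat \<Rightarrow>\<^sub>0 real) \<Rightarrow> real" and r x0 x
  assume A: "assumption_A d L1 L2 f" "0 < r" "local_error_bound d f \<kappa> r" "CRm_sequence d f M \<rho> x0 x"
  then obtain y s
    where "cubic_momentum_iteration (euclid d) f (grad d f) (hess d f) L2 M \<kappa> r x y s"
    using CRm_sequence_imp_cubic_momentum_iteration[of d L1 L2 f M \<rho> \<kappa> r x0 x] assms by blast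
  then interpret cubic_momentum_iteration "euclid d" f "grad d f" "hess d f" L2 M \<kappa> r x y s .
  have "second_order_stationary d f = stationary"
    by (simp add: second_order_stationary_def stationary_def)
  with converges_quadratically
  show "\<exists>xs \<in> second_order_stationary d f. x \<longlonglongrightarrow> xs \<and>
      (\<exists>k1. \<forall>k\<ge>k1. norm (x (Suc k) - xs) \<le> 250 * (\<kappa> + 1) * (L2 + M) * (norm (x k - xs))\<^sup>2)"
    by (simp add: eventually_sequentially)
qed

end
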